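(* Let $f\in C_B[0,\infty)$. Then for every $n\in\mathbb{N}$, every $\alpha\in[0,\frac1n]$ and every $x\in[0,\infty)$, $$\left|\mathcal{U}_{n}^{[\alpha]}(f;x)-f(x)\right|\leq 5\left\{\omega\left(f,\sqrt{\Theta_{n,2}^{[\alpha]}(x)}\right)+\frac{13}{10}\,\omega_2\left(f,\sqrt{\Theta_{n,2}^{[\alpha]}(x)}\right)\right\}.$$
   Context: For $n\in\mathbb{N}$, $0\le\alpha\le\frac1n$, $x\ge 0$ and a function $f$ on $[0,\infty)$ for which the expression converges absolutely, define $$\mathcal{U}_{n}^{[\alpha]}(f;x)=n\sum_{i=0}^{\infty}(1+n\alpha)^{-x/\alpha}\Big(\alpha+\frac1n\Big)^{-i}\frac{x^{(i,-\alpha)}}{i!}\int_0^\infty e^{-nu}\frac{(nu)^i}{i!}f(u)\,du,$$ with $x^{(0,-\alpha)}=1$ and $x^{(i,-\alpha)}=x(x+\alpha)\cdots(x+(i-1)\alpha)$; for $\alpha=0$ the coefficient is understood as its limit as $\alpha\to0$, namely $e^{-nx}\frac{(nx)^i}{i!}$. $\Theta_{n,2}^{[\alpha]}(x)=\mathcal{U}_{n}^{[\alpha]}((t-x)^2;x)=\frac{\alpha n^2x+2nx+2}{n^2}$, the operator acting on the variable $t$. $C_B[0,\infty)$ is the space of continuous bounded functions on $[0,\infty)$. For $f\in C_B[0,\infty)$ and $h>0$: $$\omega(f,h)=\sup_{x,\kappa,\lambda\ge0,\ |\kappa-\lambda|\le h}|f(x+\kappa)-f(x+\lambda)|,$$ $$\omega_2(f,h)=\sup_{x,\kappa,\lambda\ge0,\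 |\kappa-\lambda|\le h}|f(x+2\kappa)-2f(x+\kappa+\lambda)+f(x+2\lambda)|.$$ *)

theory Defs
  imports "HOL-Analysis.Analysis"
begin

text \<open>\<open>rising \<alpha> x i\<close> is the factorial power usually written as \<open>x\<close> with exponent \<open>(i, -\<alpha>)\<close>.\<close>

definition rising :: "real \<Rightarrow> real \<Rightarrow> nat \<Rightarrow> real" where
  "rising \<alpha> x i = (\<Prod>j<i. x + real j * \<alpha>)"

text \<open>For \<open>\<alpha> = 0\<close> the coefficient is its limit as \<open>\<alpha>\<close> tends to 0 (see
  \<open>stancu_coeff_tendsto\<close>); the formula of the other branch would not give it, because of
  \<open>x / 0 = 0\<close>.\<close>

definition stancu_coeff :: "nat \<Rightarrow> real \<Rightarrow> real \<Rightarrow> nat \<Rightarrow> real" where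
  "stancu_coeff n \<alpha> x i =
     (if \<alpha> = 0 then exp (- (real n * x)) * (real n * x) ^ i / fact i
      else (1 + real n * \<alpha>) powr (- x / \<alpha>) * (\<alpha> + 1 / real n) powi (- int i)
             * rising \<alpha> x i / fact i)"

lemma stancu_coeff_tendsto:
  assumes "n \<ge> 1"
  shows "((\<lambda>\<alpha>. stancu_coeff n \<alpha> x i) \<longlongrightarrow> stancu_coeff n 0 x i) (at_right 0)"
proof -
  let ?g = "\<lambda>\<alpha>. (1 + real n * \<alpha>) powr (- x / \<alpha>) * (\<alpha> + 1 / real n) powi (- int i)
             * rising \<alpha> x i / fact i"
  have 1: "((\<lambda>\<alpha>. (1 + real n * \<alpha>) powr (- x / \<alpha>)) \<longlongrightarrow> exp (- (real n * x))) (at_right 0)"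
  proof -
    have "((\<lambda>\<alpha>. (1 + real n * \<alpha>) powr (1 / \<alpha>)) \<longlongrightarrow> exp (real n)) (at_right 0)"
      by (rule tendsto_exp_limit_at_right)
    then have "((\<lambda>\<alpha>. ((1 + real n * \<alpha>) powr (1 / \<alpha>)) powr (- x)) \<longlongrightarrow> exp (real n) powr (- x))
        (at_right 0)"
      by (intro tendsto_intros) auto
    then show ?thesis
      by (simp add: powr_powr exp_powr_real)
  qed
  have 2: "((\<lambda>\<alpha>. (\<alpha> + 1 / real n) powi (- int i)) \<longlongrightarrow> (0 + 1 / real n) powi (- int i)) (at_right 0)"
    using assms by (intro tendsto_intros) auto
  have 3: "((\<lambda>\<alpha>. rising \<alpha> x i) \<longlongrightarrow> (\<Prod>j<i. x + real j * 0)) (at_right 0)"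
    unfolding rising_def by (intro tendsto_intros)
  have "(?g \<longlongrightarrow> exp (- (real n * x)) * (0 + 1 / real n) powi (- int i)
          * (\<Prod>j<i. x + real j * 0) / fact i) (at_right 0)"
    by (intro tendsto_divide tendsto_mult 1 2 3 tendsto_const) auto
  also have "exp (- (real n * x)) * (0 + 1 / real n) powi (- int i)
          * (\<Prod>j<i. x + real j * 0) / fact i = stancu_coeff n 0 x i"
    by (simp add: stancu_coeff_def power_int_minus power_mult_distrib power_divide)
  finally have g: "(?g \<longlongrightarrow> stancu_coeff n 0 x i) (at_right 0)" .
  have ev: "eventually (\<lambda>\<alpha>. ?g \<alpha> = stancu_coeff n \<alpha> x i) (at_right 0)"
    unfolding eventually_at_right_field
    by (rule exI[of _ 1]) (auto simp: stancu_coeff_def)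
  show ?thesis
    by (rule Lim_transform_eventually[OF g ev])
qed

text \<open>Functions on the half-line are total functions on the reals of which only the values on
  \<open>{0..}\<close> are used.\<close>

definition U_op :: "nat \<Rightarrow> real \<Rightarrow> (real \<Rightarrow> real) \<Rightarrow> real \<Rightarrow> real" where
  "U_op n \<alpha> f x =
     real n * (\<Sum>i. stancu_coeff n \<alpha> x i *
       (LINT u:{0..}|lborel. exp (- (real n * u)) * (real n * u) ^ i / fact i * f u))"

definition Theta2 :: "nat \<Rightarrow> real \<Rightarrow> real \<Rightarrow> real" where
  "Theta2 n \<alpha> x = U_op n \<alpha> (\<lambda>t. (t - x)\<^sup>2) x"

definition CB :: "(real \<Rightarrow> real) set" where
  "CB = {f. continuous_on {0..} f \<and> bounded (f ` {0..})}"

definition modulus1 :: "(real \<Rightarrow> real) \<Rightarrow> real \<Rightarrow> real" where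
  "modulus1 f h =
     Sup {\<bar>f (x + \<kappa>) - f (x + \<mu>)\<bar> | x \<kappa> \<mu>.
            0 \<le> x \<and> 0 \<le> \<kappa> \<and> 0 \<le> \<mu> \<and> \<bar>\<kappa> - \<mu>\<bar> \<le> h}"

definition modulus2 :: "(real \<Rightarrow> real) \<Rightarrow> real \<Rightarrow> real" where
  "modulus2 f h =
     Sup {\<bar>f (x + 2 * \<kappa>) - 2 * f (x + \<kappa> + \<mu>) + f (x + 2 * \<mu>)\<bar> | x \<kappa> \<mu>.
            0 \<le> x \<and> 0 \<le> \<kappa> \<and> 0 \<le> \<mu> \<and> \<bar>\<kappa> - \<mu>\<bar> \<le> h}"

end

theory Submission
  imports Defs "HOL-Probability.Distributions" "HOL-Real_Asymp.Real_Asymp"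
begin

text \<open>With \<open>h\<^sup>2\<close> equal to the second central moment, integrating the pointwise bound
  \<open>\<bar>f u - f x\<bar> \<le> (1 + ((u - x) / h)\<^sup>2) \<omega>(f, h)\<close> against the positive operator, which preserves
  constants, gives the bound \<open>2 \<omega>(f, h)\<close>; the second modulus only enters through its
  nonnegativity.\<close>

section \<open>Moduli of continuity\<close>

lemma CB_bounded:
  assumes "f \<in> CB"
  shows "\<exists>B. \<forall>u\<ge>0. \<bar>f u\<bar> \<le> B"
  using assms by (force simp: CB_def bounded_iff)

text \<open>Base point 0 turns the two increments into arbitrary points. Boundedness of
  \<open>f\<close> makes the set bounded above, so that \<open>Sup\<close> is an upper bound for
  it.\<close>

lemma modulus1_upper:
  assumes "f \<in> CB" "0 \<le> a" "0 \<le> b" "\<bar>a - b\<bar> \<le> h"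
  shows "\<bar>f a - f b\<bar> \<le> modulus1 f h"
proof -
  obtain B where B: "\<And>u. u \<ge> 0 \<Longrightarrow> \<bar>f u\<bar> \<le> B"
    using CB_bounded[OF assms(1)] by blast
  show ?thesis
    unfolding modulus1_def
  proof (rule cSup_upper)
    show "\<bar>f a - f b\<bar> \<in> {\<bar>f (x + \<kappa>) - f (x + \<mu>)\<bar> | x \<kappa> \<mu>.
            0 \<le> x \<and> 0 \<le> \<kappa> \<and> 0 \<le> \<mu> \<and> \<bar>\<kappa> - \<mu>\<bar> \<le> h}"
      using assms by (intro CollectI exI[of _ 0] exI[of _ a] exI[of _ b]) auto
    show "bdd_above {\<bar>f (x + \<kappa>) - f (x + \<mu>)\<bar> | x \<kappa> \<mu>.
            0 \<le> x \<and> 0 \<le> \<kappa> \<and> 0 \<le> \<mu> \<and> \<bar>\<kappa> - \<mu>\<bar> \<le> h}"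
    proof (rule bdd_aboveI[of _ "2 * B"])
      fix y assume "y \<in> {\<bar>f (x + \<kappa>) - f (x + \<mu>)\<bar> | x \<kappa> \<mu>.
            0 \<le> x \<and> 0 \<le> \<kappa> \<and> 0 \<le> \<mu> \<and> \<bar>\<kappa> - \<mu>\<bar> \<le> h}"
      then obtain x \<kappa> \<mu> where y: "y = \<bar>f (x + \<kappa>) - f (x + \<mu>)\<bar>" "0 \<le> x" "0 \<le> \<kappa>" "0 \<le> \<mu>"
        by blast
      show "y \<le> 2 * B"
        using B[of "x + \<kappa>"] B[of "x + \<mu>"] y by linarith
    qed
  qed
qed

text \<open>The value 0 occurs at \<open>x = \<kappa> = \<mu> = 0\<close>; it lies below the real
  \<open>Sup\<close> because \<open>4 * B\<close> bounds the set.\<close>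

lemma modulus2_nonneg:
  assumes "f \<in> CB" "0 \<le> h"
  shows "0 \<le> modulus2 f h"
proof -
  obtain B where B: "\<And>u. u \<ge> 0 \<Longrightarrow> \<bar>f u\<bar> \<le> B"
    using CB_bounded[OF assms(1)] by blast
  show ?thesis
    unfolding modulus2_def
  proof (rule cSup_upper)
    show "0 \<in> {\<bar>f (x + 2 * \<kappa>) - 2 * f (x + \<kappa> + \<mu>) + f (x + 2 * \<mu>)\<bar> | x \<kappa> \<mu>.
            0 \<le> x \<and> 0 \<le> \<kappa> \<and> 0 \<le> \<mu> \<and> \<bar>\<kappa> - \<mu>\<bar> \<le> h}"
      using assms by (intro CollectI exI[of _ 0]) auto
    show "bdd_above {\<bar>f (x + 2 * \<kappa>) - 2 * f (x + \<kappa> + \<mu>) + f (x + 2 * \<mu>)\<bar> | x \<kappa> \<mu>.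
            0 \<le> x \<and> 0 \<le> \<kappa> \<and> 0 \<le> \<mu> \<and> \<bar>\<kappa> - \<mu>\<bar> \<le> h}"
    proof (rule bdd_aboveI[of _ "4 * B"])
      fix y assume "y \<in> {\<bar>f (x + 2 * \<kappa>) - 2 * f (x + \<kappa> + \<mu>) + f (x + 2 * \<mu>)\<bar> | x \<kappa> \<mu>.
            0 \<le> x \<and> 0 \<le> \<kappa> \<and> 0 \<le> \<mu> \<and> \<bar>\<kappa> - \<mu>\<bar> \<le> h}"
      then obtain x \<kappa> \<mu> where y: "y = \<bar>f (x + 2 * \<kappa>) - 2 * f (x + \<kappa> + \<mu>) + f (x + 2 * \<mu>)\<bar>"
          "0 \<le> x" "0 \<le> \<kappa>" "0 \<le> \<mu>"
        by blast
      show "y \<le> 4 * B"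
        using B[of "x + 2 * \<kappa>"] B[of "x + \<kappa> + \<mu>"] B[of "x + 2 * \<mu>"] y by linarith
    qed
  qed
qed

text \<open>Cut the segment between \<open>a\<close> and \<open>b\<close> into \<open>k\<close>
  equal pieces of length at most \<open>h\<close>; each piece costs one modulus.\<close>

lemma modulus1_chain:
  assumes "f \<in> CB" "0 \<le> a" "0 \<le> b" "0 \<le> h" "\<bar>a - b\<bar> \<le> real k * h"
  shows "\<bar>f a - f b\<bar> \<le> real k * modulus1 f h"
  using assms(3,5)
proof (induction k arbitrary: b)
  case 0
  then show ?case by simp
next
  case (Suc k)
  \<comment> \<open>The division point next to \<open>b\<close>: the last of the
    \<open>k + 1\<close> equal pieces is split off, and the first \<open>k\<close> are left to the
    induction hypothesis.\<close>
  define c where "c = (a + real k * b) / real (Suc k)"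
  have c: "0 \<le> c"
    using assms Suc.prems by (simp add: c_def)
  have "\<bar>a - b\<bar> / real (Suc k) \<le> h"
    using Suc.prems by (simp add: field_simps)
  moreover have "c - b = (a - b) / real (Suc k)" "a - c = real k * ((a - b) / real (Suc k))"
    by (simp_all add: c_def field_simps)
  ultimately have 1: "\<bar>c - b\<bar> \<le> h" and 2: "\<bar>a - c\<bar> \<le> real k * h"
    by (simp_all add: abs_mult mult_left_mono del: of_nat_Suc times_divide_eq_right)
  show ?case
    using Suc.IH[OF c 2] modulus1_upper[OF assms(1) c Suc.prems(1) 1]
    by (simp add: algebra_simps)
qed

text \<open>About \<open>t = \<bar>a - b\<bar> / h\<close> steps suffice in the chain. Bounding
  their number by 1 plus the square of \<open>t\<close> gives a weight that integrates to a second
  moment.\<close>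

lemma modulus1_quadratic:
  assumes "f \<in> CB" "0 \<le> a" "0 \<le> b" "0 < h"
  shows "\<bar>f a - f b\<bar> \<le> (1 + ((a - b) / h)\<^sup>2) * modulus1 f h"
proof -
  define t where "t = \<bar>a - b\<bar> / h"
  have t0: "0 \<le> t"
    using assms by (simp add: t_def)
  have w: "0 \<le> modulus1 f h"
    using modulus1_upper[OF assms(1), of 0 0 h] assms by simp
  \<comment> \<open>One step is enough for \<open>t \<le> 1\<close>. Otherwise the ceiling of
    \<open>t\<close> is below \<open>t + 1\<close>, and \<open>t\<close> is at most its own
    square.\<close>
  have "\<exists>k::nat. t \<le> real k \<and> real k \<le> 1 + t\<^sup>2"
  proof (cases "t \<le> 1")
    case True
    then show ?thesis by (intro exI[of _ 1]) auto
  next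
    case False
    have "t * 1 \<le> t * t"
      using False by (intro mult_left_mono) auto
    then show ?thesis
      using t0 by (intro exI[of _ "nat \<lceil>t\<rceil>"]) (auto simp: power2_eq_square, linarith+)
  qed
  then obtain k :: nat where k: "t \<le> real k" "real k \<le> 1 + t\<^sup>2"
    by blast
  have "\<bar>a - b\<bar> \<le> real k * h"
    using k(1) assms by (simp add: t_def field_simps)
  then have "\<bar>f a - f b\<bar> \<le> real k * modulus1 f h"
    using assms by (intro modulus1_chain) auto
  also have "\<dots> \<le> (1 + t\<^sup>2) * modulus1 f h"
    using k w by (intro mult_right_mono)
  finally show ?thesis
    by (simp add: t_def power_divide)
qed

section \<open>The Stancu coefficients\<close>

lemma stancu_coeff_nonneg:
  assumes "0 \<le> \<alpha>" "0 \<le> x"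
  shows "0 \<le> stancu_coeff n \<alpha> x i"
  using assms
  by (auto simp: stancu_coeff_def rising_def
      intro!: mult_nonneg_nonneg divide_nonneg_nonneg prod_nonneg)

lemma stancu_coeff_0_pos:
  assumes "0 \<le> \<alpha>"
  shows "0 < stancu_coeff n \<alpha> x 0"
  using assms by (auto simp: stancu_coeff_def rising_def add_nonneg_eq_0_iff)

text \<open>This recurrence covers both branches of the definition at once; for
  \<open>\<alpha> = 0\<close> it is the ratio of consecutive Poisson weights.\<close>

lemma stancu_coeff_Suc:
  assumes "n \<ge> 1" "0 \<le> \<alpha>"
  shows "stancu_coeff n \<alpha> x (Suc i) = stancu_coeff n \<alpha> x i *
    ((real n * x + real i * (real n * \<alpha>)) / ((1 + real n * \<alpha>) * (real i + 1)))"
proof (cases "\<alpha> = 0")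
  case True
  then show ?thesis by (simp add: stancu_coeff_def field_simps)
next
  case False
  have "0 < real n" "0 < \<alpha> + 1 / real n" "0 < 1 + real n * \<alpha>"
    using assms by (auto simp: add_nonneg_pos add_pos_nonneg)
  moreover from this have "(x + real i * \<alpha>) / (\<alpha> + 1 / real n)
      = (real n * x + real i * (real n * \<alpha>)) / (1 + real n * \<alpha>)"
    by (simp add: field_simps)
  moreover have "stancu_coeff n \<alpha> x (Suc i) = stancu_coeff n \<alpha> x i *
      ((x + real i * \<alpha>) / (\<alpha> + 1 / real n) / (real i + 1))"
    using False
    by (simp add: stancu_coeff_def rising_def power_int_minus del: of_nat_Suc)
       (simp add: divide_inverse mult.assoc mult.left_commute add.commute)
  ultimately show ?thesis by simp
qed

text \<open>For \<open>\<alpha> = 0\<close> this is the exponential series. Otherwise it is the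
  binomial series of \<open>1 - q\<close> with exponent \<open>- x / \<alpha>\<close>; for positive
  \<open>x\<close> the coefficients are then negative binomial weights.\<close>

lemma stancu_coeff_sums_1:
  assumes "n \<ge> 1" "0 \<le> \<alpha>"
  shows "(\<lambda>i. stancu_coeff n \<alpha> x i) sums 1"
proof (cases "\<alpha> = 0")
  case True
  have "(\<lambda>i. exp (- (real n * x)) * ((real n * x) ^ i /\<^sub>R fact i)) sums
      (exp (- (real n * x)) * exp (real n * x))"
    by (intro sums_mult exp_converges)
  then show ?thesis
    by (simp add: True stancu_coeff_def exp_minus field_simps)
next
  case False
  then have pos: "0 < \<alpha>" "0 < real n"
    using assms by auto
  define q where "q = \<alpha> / (\<alpha> + 1 / real n)"
  have q: "0 < q" "q < 1"
    using pos by (auto simp: q_def field_simps add_pos_pos)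
  \<comment> \<open>Hence the sum of the binomial series is the reciprocal of the normalising factor
    of the coefficients.\<close>
  have q1: "1 - q = 1 / (1 + real n * \<alpha>)"
    using pos add_pos_pos[of 1 "real n * \<alpha>"]
    by (simp add: q_def field_simps add_divide_distrib[symmetric])
  have ris: "rising \<alpha> x i = \<alpha> ^ i * pochhammer (x / \<alpha>) i" for i
  proof -
    have "rising \<alpha> x i = (\<Prod>j<i. \<alpha> * (x / \<alpha> + real j))"
      unfolding rising_def using pos by (intro prod.cong) (auto simp: field_simps)
    then show ?thesis
      by (simp add: prod.distrib pochhammer_prod atLeast0LessThan)
  qed
  have base: "0 < 1 + real n * \<alpha>"
    using pos by (simp add: add_pos_pos)
  have "(\<lambda>i. (1 + real n * \<alpha>) powr (- x / \<alpha>) * (((- x / \<alpha>) gchoose i) * (- q) ^ i)) sums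
      ((1 + real n * \<alpha>) powr (- x / \<alpha>) * (1 + - q) powr (- x / \<alpha>))"
    using q by (intro sums_mult gen_binomial_real) auto
  also have "(1 + - q) powr (- x / \<alpha>) = (1 + real n * \<alpha>) powr (x / \<alpha>)"
    using q1 base by (simp add: powr_divide powr_minus)
  also have "(1 + real n * \<alpha>) powr (- x / \<alpha>) * (1 + real n * \<alpha>) powr (x / \<alpha>) = 1"
    using base by (simp flip: powr_add)
  also have "(\<lambda>i. (1 + real n * \<alpha>) powr (- x / \<alpha>) * (((- x / \<alpha>) gchoose i) * (- q) ^ i))
      = (\<lambda>i. stancu_coeff n \<alpha> x i)"
  proof
    fix i
    \<comment> \<open>The sign in the generalised binomial coefficient cancels the sign of
      \<open>- q\<close>.\<close>
    have "((- x / \<alpha>) gchoose i) * (- q) ^ i = ((-1) * (- q)) ^ i * pochhammer (x / \<alpha>) i / fact i"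
      by (simp only: gbinomial_pochhammer power_mult_distrib) simp
    also have "\<dots> = (\<alpha> + 1 / real n) powi (- int i) * rising \<alpha> x i / fact i"
      by (simp add: ris q_def power_int_minus power_divide field_simps)
    finally show "(1 + real n * \<alpha>) powr (- x / \<alpha>) * (((- x / \<alpha>) gchoose i) * (- q) ^ i)
        = stancu_coeff n \<alpha> x i"
      using False by (simp add: stancu_coeff_def)
  qed
  finally show ?thesis .
qed

text \<open>Ratio test: consecutive terms have ratio tending to \<open>p / (1 + p) < 1\<close>,
  where \<open>p = real n * \<alpha>\<close>. The weight dominates the second moments of the Erlang
  densities.\<close>

lemma summable_stancu_coeff_quadratic:
  assumes "n \<ge> 1" "0 \<le> \<alpha>" "0 \<le> x"
  shows "summable (\<lambda>i. stancu_coeff n \<alpha> x i * (real i + 1)\<^sup>2)"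
proof -
  define p where "p = real n * \<alpha>"
  define r where "r i = (real n * x + real i * p) / ((1 + p) * (real i + 1))
      * ((real i + 2) / (real i + 1))\<^sup>2" for i :: nat
  have p: "0 \<le> p"
    using assms by (simp add: p_def)
  have "r \<longlonglongrightarrow> p / (1 + p)"
    unfolding r_def using p by (real_asymp simp: divide_inverse)
  \<comment> \<open>The midpoint between the limit and 1 serves as the constant of the ratio
    test.\<close>
  moreover have "p / (1 + p) < (p / (1 + p) + 1) / 2"
    using p by (simp add: field_simps)
  ultimately have "eventually (\<lambda>i. r i < (p / (1 + p) + 1) / 2) sequentially"
    by (rule order_tendstoD)
  then obtain N where N: "\<And>i. i \<ge> N \<Longrightarrow> r i < (p / (1 + p) + 1) / 2"
    by (auto simp: eventually_sequentially)
  show ?thesis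
  proof (rule summable_ratio_test)
    show "(p / (1 + p) + 1) / 2 < 1"
      using p by (simp add: field_simps)
    fix i assume "i \<ge> N"
    have "stancu_coeff n \<alpha> x (Suc i) * (real (Suc i) + 1)\<^sup>2
        = r i * (stancu_coeff n \<alpha> x i * (real i + 1)\<^sup>2)"
      using assms(1,2)
      by (simp add: stancu_coeff_Suc r_def p_def power_divide add.commute)
    also have "\<dots> \<le> (p / (1 + p) + 1) / 2 * (stancu_coeff n \<alpha> x i * (real i + 1)\<^sup>2)"
      using N[OF \<open>i \<ge> N\<close>] assms by (intro mult_right_mono mult_nonneg_nonneg stancu_coeff_nonneg) auto
    finally show "norm (stancu_coeff n \<alpha> x (Suc i) * (real (Suc i) + 1)\<^sup>2)
        \<le> (p / (1 + p) + 1) / 2 * norm (stancu_coeff n \<alpha> x i * (real i + 1)\<^sup>2)"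
      using assms by (simp add: stancu_coeff_nonneg abs_mult)
  qed
qed

section \<open>Integration against the Erlang densities\<close>

lemma has_bochner_integral_erlang_moment:
  assumes "0 < l"
  shows "has_bochner_integral lborel (\<lambda>u. erlang_density i l u * u ^ k)
    (fact (i + k) / (fact i * l ^ k))"
proof (rule has_bochner_integral_nn_integral)
  \<comment> \<open>The density vanishes for negative \<open>u\<close>, where an odd power would be
    negative.\<close>
  show "AE u in lborel. 0 \<le> erlang_density i l u * u ^ k"
    using assms by (auto simp: erlang_density_def)
qed (use assms in \<open>simp_all add: nn_integral_erlang_ith_moment\<close>)

lemma has_bochner_integral_erlang_1:
  assumes "0 < l"
  shows "has_bochner_integral lborel (erlang_density i l) 1"
  using has_bochner_integral_erlang_moment[OF assms, of i 0] by simp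

text \<open>Squared bias plus variance: the density has mean \<open>(real i + 1) / l\<close> and
  variance \<open>(real i + 1) / l\<^sup>2\<close>. Expanding the square reduces this to the moments
  of order 2, 1 and 0.\<close>

lemma has_bochner_integral_erlang_square:
  assumes "0 < l"
  shows "has_bochner_integral lborel (\<lambda>u. erlang_density i l u * (u - x)\<^sup>2)
    (((real i + 1) / l - x)\<^sup>2 + (real i + 1) / l\<^sup>2)"
proof -
  note m = has_bochner_integral_erlang_moment[OF assms, of i]
  have "has_bochner_integral lborel
      (\<lambda>u. erlang_density i l u * u ^ 2 + (- 2 * x) * (erlang_density i l u * u ^ 1)
        + x\<^sup>2 * (erlang_density i l u * u ^ 0))
      (fact (i + 2) / (fact i * l ^ 2) + (- 2 * x) * (fact (i + 1) / (fact i * l ^ 1))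
        + x\<^sup>2 * (fact (i + 0) / (fact i * l ^ 0)))"
    by (intro has_bochner_integral_add has_bochner_integral_mult_right m)
  moreover have "fact (i + 2) / (fact i * l ^ 2) + (- 2 * x) * (fact (i + 1) / (fact i * l ^ 1))
        + x\<^sup>2 * (fact (i + 0) / (fact i * l ^ 0))
      = ((real i + 1) / l - x)\<^sup>2 + (real i + 1) / l\<^sup>2"
  proof -
    have "(fact (i + 2) :: real) = (real i + 2) * (real i + 1) * fact i"
         "(fact (i + 1) :: real) = (real i + 1) * fact i"
      by (simp_all add: numeral_2_eq_2 algebra_simps)
    then show ?thesis
      using assms by (simp add: power2_eq_square field_simps)
  qed
  moreover have "(\<lambda>u. erlang_density i l u * u ^ 2 + (- 2 * x) * (erlang_density i l u * u ^ 1)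
        + x\<^sup>2 * (erlang_density i l u * u ^ 0)) = (\<lambda>u. erlang_density i l u * (u - x)\<^sup>2)"
    by (auto simp: power2_eq_square algebra_simps)
  ultimately show ?thesis
    by simp
qed

section \<open>The operator as a series of Erlang means, and its second central moment\<close>

text \<open>The kernel of the operator times \<open>real n\<close> is an Erlang density, which
  vanishes for negative \<open>u\<close>; this absorbs the outer factor and extends the integral to
  the whole line.\<close>

lemma U_op_eq_sums:
  assumes "n \<ge> 1"
    and "(\<lambda>i. stancu_coeff n \<alpha> x i * (LINT u|lborel. erlang_density i (real n) u * g u)) sums s"
  shows "U_op n \<alpha> g x = s"
proof -
  have n: "real n \<noteq> 0"
    using assms by simp
  have "(LINT u|lborel. erlang_density i (real n) u * g u) = real n *
      (LINT u:{0..}|lborel. exp (- (real n * u)) * (real n * u) ^ i / fact i * g u)" for i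
    unfolding set_lebesgue_integral_def
    by (subst integral_mult_right_zero[symmetric], rule Bochner_Integration.integral_cong)
       (auto simp: erlang_density_def indicator_def power_mult_distrib)
  then have "(\<lambda>i. real n * (stancu_coeff n \<alpha> x i *
      (LINT u:{0..}|lborel. exp (- (real n * u)) * (real n * u) ^ i / fact i * g u))) sums s"
    using assms(2) by (simp add: mult.left_commute)
  from sums_mult[OF this, of "1 / real n"] show ?thesis
    using n by (simp add: U_op_def sums_iff)
qed

text \<open>Integrating term by term gives the weights \<open>d i\<close>. Convergence, by
  comparison with a multiple of \<open>(real i + 1)\<^sup>2\<close>, identifies the
  \<open>suminf\<close> inside \<open>U_op\<close> with an actual sum.\<close>

lemma Theta2_sums:
  assumes "n \<ge> 1" "0 \<le> \<alpha>" "0 \<le> x"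
  shows "(\<lambda>i. stancu_coeff n \<alpha> x i * (((real i + 1) / real n - x)\<^sup>2 + (real i + 1) / (real n)\<^sup>2))
    sums Theta2 n \<alpha> x"
proof -
  define d where "d i = ((real i + 1) / real n - x)\<^sup>2 + (real i + 1) / (real n)\<^sup>2" for i :: nat
  have n: "0 < real n"
    using assms by simp
  have "summable (\<lambda>i. stancu_coeff n \<alpha> x i * d i)"
  proof (rule summable_comparison_test')
    show "summable (\<lambda>i. (2 / (real n)\<^sup>2 + x\<^sup>2) * (stancu_coeff n \<alpha> x i * (real i + 1)\<^sup>2))"
      by (intro summable_mult summable_stancu_coeff_quadratic assms)
    fix i :: nat
    have d0: "0 \<le> d i"
      by (simp add: d_def)
    have sq: "real i + 1 \<le> (real i + 1)\<^sup>2" "1 \<le> (real i + 1)\<^sup>2"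
      by (simp_all add: power2_eq_square algebra_simps)
    have "0 \<le> 2 * ((real i + 1) / real n) * x"
      using assms by simp
    then have "d i \<le> (real i + 1)\<^sup>2 / (real n)\<^sup>2 + x\<^sup>2 + (real i + 1) / (real n)\<^sup>2"
      unfolding d_def power2_diff power_divide by linarith
    also have "\<dots> \<le> (real i + 1)\<^sup>2 / (real n)\<^sup>2 + x\<^sup>2 * (real i + 1)\<^sup>2 + (real i + 1)\<^sup>2 / (real n)\<^sup>2"
      using sq mult_left_mono[OF sq(2), of "x\<^sup>2"]
      by (intro add_mono divide_right_mono) auto
    also have "\<dots> = (2 / (real n)\<^sup>2 + x\<^sup>2) * (real i + 1)\<^sup>2"
      by (simp add: algebra_simps)
    finally have "stancu_coeff n \<alpha> x i * d i
        \<le> stancu_coeff n \<alpha> x i * ((2 / (real n)\<^sup>2 + x\<^sup>2) * (real i + 1)\<^sup>2)"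
      using assms by (intro mult_left_mono stancu_coeff_nonneg)
    then show "norm (stancu_coeff n \<alpha> x i * d i)
        \<le> (2 / (real n)\<^sup>2 + x\<^sup>2) * (stancu_coeff n \<alpha> x i * (real i + 1)\<^sup>2)"
      using assms d0 by (simp add: stancu_coeff_nonneg abs_mult mult.left_commute)
  qed
  then obtain s where s: "(\<lambda>i. stancu_coeff n \<alpha> x i * d i) sums s"
    by (auto simp: summable_def)
  have "(LINT u|lborel. erlang_density i (real n) u * (u - x)\<^sup>2) = d i" for i
    unfolding d_def
    by (rule has_bochner_integral_integral_eq[OF has_bochner_integral_erlang_square[OF n]])
  then have "Theta2 n \<alpha> x = s"
    unfolding Theta2_def using s assms by (intro U_op_eq_sums) auto
  then show ?thesis
    using s by (simp add: d_def)
qed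

text \<open>The term with index 0 already contains a positive variance times a positive coefficient.
  Positivity permits division by \<open>h\<close> later.\<close>

lemma Theta2_pos:
  assumes "n \<ge> 1" "0 \<le> \<alpha>" "0 \<le> x"
  shows "0 < Theta2 n \<alpha> x"
proof -
  let ?t = "\<lambda>i. stancu_coeff n \<alpha> x i * (((real i + 1) / real n - x)\<^sup>2 + (real i + 1) / (real n)\<^sup>2)"
  have "0 < ?t 0"
    using assms stancu_coeff_0_pos[of \<alpha> n x] by (intro mult_pos_pos add_nonneg_pos) auto
  moreover have "0 \<le> ?t i" for i
    using assms by (intro mult_nonneg_nonneg stancu_coeff_nonneg) auto
  ultimately have "0 < suminf ?t"
    using sums_summable[OF Theta2_sums[OF assms]] by (intro suminf_pos2[where i = 0]) auto
  then show ?thesis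
    using sums_unique[OF Theta2_sums[OF assms]] by simp
qed

section \<open>Deviation of the operator from the function\<close>

text \<open>Since the density has mass 1, \<open>f x\<close> is the mean of a constant; the
  quadratic modulus bound is then integrated against the density.\<close>

lemma erlang_mean_deviation:
  assumes "f \<in> CB" "0 < l" "0 \<le> x" "0 < h"
  shows "\<bar>(LINT u|lborel. erlang_density i l u * f u) - f x\<bar>
    \<le> (1 + (((real i + 1) / l - x)\<^sup>2 + (real i + 1) / l\<^sup>2) / h\<^sup>2) * modulus1 f h"
proof -
  let ?e = "erlang_density i l"
  let ?d = "((real i + 1) / l - x)\<^sup>2 + (real i + 1) / l\<^sup>2"
  note e1 = has_bochner_integral_erlang_1[OF assms(2), of i]
  obtain B where B: "\<And>u. u \<ge> 0 \<Longrightarrow> \<bar>f u\<bar> \<le> B"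
    using CB_bounded[OF assms(1)] by blast
  \<comment> \<open>Nothing is known about \<open>f\<close> on negative arguments. The density
    vanishes there, so \<open>f\<close> may be cut off, and the cut-off function is measurable by
    continuity on \<open>{0..}\<close>.\<close>
  have ef: "?e u * f u = ?e u * (indicator {0..} u *\<^sub>R f u)" for u
    by (simp add: erlang_density_def)
  have [measurable]: "(\<lambda>u. indicator {0..} u *\<^sub>R f u) \<in> borel_measurable borel"
    using assms(1) by (intro borel_measurable_continuous_on_indicator) (auto simp: CB_def)
  have int: "integrable lborel (\<lambda>u. ?e u * f u)"
  proof (rule Bochner_Integration.integrable_bound)
    show "integrable lborel (\<lambda>u. B * ?e u)"
      using e1 by (auto simp: has_bochner_integral_iff)
    show "(\<lambda>u. ?e u * f u) \<in> borel_measurable lborel"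
      unfolding ef by measurable
    have "\<bar>?e u * f u\<bar> \<le> \<bar>B * ?e u\<bar>" for u
    proof (cases "u < 0")
      case False
      then have "\<bar>f u\<bar> \<le> \<bar>B\<bar>"
        using B[of u] by linarith
      then show ?thesis
        by (simp add: abs_mult mult_right_mono mult.commute[of "?e u"])
    qed (simp add: erlang_density_def)
    then show "AE u in lborel. norm (?e u * f u) \<le> norm (B * ?e u)"
      by simp
  qed
  have dev: "has_bochner_integral lborel (\<lambda>u. ?e u * f u - f x * ?e u)
      ((LINT u|lborel. ?e u * f u) - f x * 1)"
    by (intro has_bochner_integral_diff has_bochner_integral_mult_right e1
        has_bochner_integral_integrable int)
  have maj: "has_bochner_integral lborel
      (\<lambda>u. modulus1 f h * (?e u + 1 / h\<^sup>2 * (?e u * (u - x)\<^sup>2)))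
      (modulus1 f h * (1 + 1 / h\<^sup>2 * ?d))"
    by (intro has_bochner_integral_mult_right has_bochner_integral_add e1
        has_bochner_integral_erlang_square assms)
  have "\<bar>(LINT u|lborel. ?e u * f u) - f x * 1\<bar> = \<bar>LINT u|lborel. ?e u * f u - f x * ?e u\<bar>"
    using dev by (simp add: has_bochner_integral_iff)
  also have "\<dots> \<le> (LINT u|lborel. \<bar>?e u * f u - f x * ?e u\<bar>)"
    by (rule integral_abs_bound)
  also have "\<dots> \<le> (LINT u|lborel. modulus1 f h * (?e u + 1 / h\<^sup>2 * (?e u * (u - x)\<^sup>2)))"
  proof (rule integral_mono)
    show "integrable lborel (\<lambda>u. \<bar>?e u * f u - f x * ?e u\<bar>)"
      using dev by (intro integrable_abs) (auto simp: has_bochner_integral_iff)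
    show "integrable lborel (\<lambda>u. modulus1 f h * (?e u + 1 / h\<^sup>2 * (?e u * (u - x)\<^sup>2)))"
      using maj by (simp add: has_bochner_integral_iff)
    fix u :: real
    show "\<bar>?e u * f u - f x * ?e u\<bar> \<le> modulus1 f h * (?e u + 1 / h\<^sup>2 * (?e u * (u - x)\<^sup>2))"
    proof (cases "u < 0")
      case False
      have "\<bar>?e u * f u - f x * ?e u\<bar> = ?e u * \<bar>f u - f x\<bar>"
        using assms(2) by (simp add: abs_mult mult.commute[of "f x"] flip: right_diff_distrib)
      also have "\<dots> \<le> ?e u * ((1 + ((u - x) / h)\<^sup>2) * modulus1 f h)"
        using assms False by (intro mult_left_mono modulus1_quadratic) auto
      finally show ?thesis
        by (simp add: algebra_simps power_divide)
    qed (simp add: erlang_density_def)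
  qed
  also have "\<dots> = modulus1 f h * (1 + 1 / h\<^sup>2 * ?d)"
    using maj by (simp only: has_bochner_integral_iff)
  finally show ?thesis
    by (simp add: mult.commute)
qed

text \<open>Averaging the Erlang estimates with weights \<open>c i\<close> of sum 1 replaces
  \<open>d i\<close> by \<open>Theta2 n \<alpha> x\<close>.\<close>

lemma U_op_deviation_le:
  assumes "f \<in> CB" "n \<ge> 1" "0 \<le> \<alpha>" "0 \<le> x"
  shows "\<bar>U_op n \<alpha> f x - f x\<bar> \<le> 2 * modulus1 f (sqrt (Theta2 n \<alpha> x))"
proof -
  define h where "h = sqrt (Theta2 n \<alpha> x)"
  have \<Theta>: "0 < Theta2 n \<alpha> x"
    using Theta2_pos assms by blast
  have h: "0 < h" "h\<^sup>2 = Theta2 n \<alpha> x"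
    using \<Theta> by (auto simp: h_def)
  define c where "c = stancu_coeff n \<alpha> x"
  define d where "d i = ((real i + 1) / real n - x)\<^sup>2 + (real i + 1) / (real n)\<^sup>2" for i :: nat
  define m where "m i = (LINT u|lborel. erlang_density i (real n) u * f u)" for i
  have c0: "0 \<le> c i" for i
    using assms by (simp add: c_def stancu_coeff_nonneg)
  have c1: "c sums 1"
    unfolding c_def using assms by (intro stancu_coeff_sums_1)
  have "(\<lambda>i. (c i + 1 / h\<^sup>2 * (c i * d i)) * modulus1 f h) sums
      ((1 + 1 / h\<^sup>2 * Theta2 n \<alpha> x) * modulus1 f h)"
    using Theta2_sums[of n \<alpha> x] assms
    by (intro sums_mult2 sums_add sums_mult c1) (auto simp: c_def d_def)
  \<comment> \<open>The choice of \<open>h\<close> makes the quotient of the second moment by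
    \<open>h\<^sup>2\<close> equal to 1, hence the factor 2.\<close>
  then have maj: "(\<lambda>i. (c i + 1 / h\<^sup>2 * (c i * d i)) * modulus1 f h) sums (2 * modulus1 f h)"
    using h \<Theta> by simp
  have le: "norm (c i * (m i - f x)) \<le> (c i + 1 / h\<^sup>2 * (c i * d i)) * modulus1 f h" for i
  proof -
    have "\<bar>m i - f x\<bar> \<le> (1 + d i / h\<^sup>2) * modulus1 f h"
      unfolding m_def d_def using assms h by (intro erlang_mean_deviation) auto
    then have "c i * \<bar>m i - f x\<bar> \<le> c i * ((1 + d i / h\<^sup>2) * modulus1 f h)"
      using c0 by (intro mult_left_mono)
    then show ?thesis
      using c0[of i] unfolding real_norm_def abs_mult by (simp add: algebra_simps)
  qed
  have sm: "summable (\<lambda>i. c i * (m i - f x))"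
    using le by (intro summable_comparison_test'[OF sums_summable[OF maj]])
  \<comment> \<open>Adding \<open>f x\<close> back, again through total weight 1, gives convergence
    of the series of the operator from that of the deviations.\<close>
  have "(\<lambda>i. c i * (m i - f x) + c i * f x) sums ((\<Sum>i. c i * (m i - f x)) + 1 * f x)"
    by (intro sums_add summable_sums sm sums_mult2 c1)
  then have "(\<lambda>i. c i * m i) sums ((\<Sum>i. c i * (m i - f x)) + f x)"
    by (simp add: algebra_simps)
  then have "U_op n \<alpha> f x = (\<Sum>i. c i * (m i - f x)) + f x"
    using assms(2) by (intro U_op_eq_sums) (auto simp: c_def m_def)
  moreover have "norm (\<Sum>i. c i * (m i - f x)) \<le> 2 * modulus1 f h"
    unfolding sums_unique[OF maj] by (rule norm_suminf_le[OF le sums_summable[OF maj]])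
  ultimately show ?thesis
    by (simp add: h_def)
qed

theorem theorem3p4:
  fixes f :: "real \<Rightarrow> real" and n :: nat and \<alpha> x :: real
  assumes "f \<in> CB"
    and "n \<ge> 1"
    and "0 \<le> \<alpha>" and "\<alpha> \<le> 1 / real n"
    and "0 \<le> x"
  shows "\<bar>U_op n \<alpha> f x - f x\<bar>
    \<le> 5 * (modulus1 f (sqrt (Theta2 n \<alpha> x)) + 13 / 10 * modulus2 f (sqrt (Theta2 n \<alpha> x)))"
proof -
  have "0 \<le> sqrt (Theta2 n \<alpha> x)"
    using Theta2_pos[of n \<alpha> x] assms by simp
  \<comment> \<open>Nonnegativity allows the factor 2 to be raised to 5 and the second modulus to be
    added.\<close>
  then have "0 \<le> modulus1 f (sqrt (Theta2 n \<alpha> x))" "0 \<le> modulus2 f (sqrt (Theta2 n \<alpha> x))"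
    using modulus1_upper[OF assms(1), of 0 0] modulus2_nonneg[OF assms(1)] by auto
  moreover have "\<bar>U_op n \<alpha> f x - f x\<bar> \<le> 2 * modulus1 f (sqrt (Theta2 n \<alpha> x))"
    using assms by (intro U_op_deviation_le)
  ultimately show ?thesis
    unfolding distrib_left by linarith
qed

end
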